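(* The simple vertex operator algebra $\mathcal{L}(1,0,0)$ associated to the $\mathcal{W}_3$ algebra with central charge $1$ is not completely reducible as an $L(1,0)$-module, where $L(1,0)$ is the Virasoro vertex operator subalgebra generated by $\omega$.
   Context: $\mathcal{W}_3$ is the associative algebra generated by $L_m,W_m$ ($m\in\mathbb{Z}$) and a non-zero central element $C$ subject to $$[L_m,L_n]=(m-n)L_{m+n}+\delta_{m+n,0}\tfrac{m^3-m}{12}C,\qquad [L_m,W_n]=(2m-n)W_{m+n},$$ $$[W_m,W_n]=(m-n)\Big[\tfrac1{15}(m+n+2)(m+n+3)-\tfrac16(m+2)(n+2)\Big]L_{m+n}+\tfrac{16}{22+5C}(m-n)\Lambda_{m+n}+\tfrac{m(m^2-1)(m^2-4)}{360}\delta_{m+n,0}C,$$ where $\Lambda_m=\sum_{j\ge 2}L_{-j}L_{m+j}+\sum_{j\ge -1}L_{m-j}L_j-\tfrac{3}{10}(m+2)(m+3)L_m$ (the infinite sums act as finite sums on the highest weight modules considered). For $c,\lambda,\mu\in\mathbb{C}$, $\mathcal{M}(c,\lambda,\mu)$ is the module induced from the one-dimensional module $\mathbb{C}\mathbf{1}_{\lambda,\mu}$ of the subalgebra generated by $L_m,W_m$ ($m\ge 0$) and $C$, on which $L_0=\lambda$, $W_0=\mu$, $C=c$, $L_m=W_m=0$ for $m>0$. $\mathcal{L}(c,\lambda,\mu)$ is its unique irreducible quotient. Writing $\mathbf{1}=\mathbf{1}_{0,0}$, let $\bar{\mathcal{M}}(c,0,0)$ be the quotient of $\mathcal{M}(c,0,0)$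 by the submodule generated by $L_{-1}\mathbf{1},W_{-1}\mathbf{1},W_{-2}\mathbf{1}$. It is a vertex operator algebra generated by $\omega=L_{-2}\mathbf{1}$ and $w=W_{-3}\mathbf{1}$ with $Y(\omega,z)=\sum_n L_nz^{-n-2}$ and $Y(w,z)=\sum_n W_nz^{-n-3}$, and $\mathcal{L}(c,0,0)$ is its simple quotient vertex operator algebra. For $c=1$ the vertex operator subalgebra generated by $\omega$ is $L(1,0)$, the simple Virasoro vertex operator algebra of central charge $1$. *)

theory Defs
  imports "HOL-Analysis.Analysis" "HOL-Library.Poly_Mapping"
begin

section \<open>The free associative algebra on the symbols \<open>L\<^sub>m\<close> and \<open>W\<^sub>m\<close>\<close>

datatype w3_gen = GenL int | GenW int

datatype w3_word = Word (letters: "w3_gen list")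

instantiation w3_word :: monoid_add
begin

definition zero_w3_word :: w3_word where "0 = Word []"

definition plus_w3_word :: "w3_word \<Rightarrow> w3_word \<Rightarrow> w3_word"
  where "u + v = Word (letters u @ letters v)"

instance
  by standard (auto simp: zero_w3_word_def plus_w3_word_def)

end

text \<open>Since addition of words is concatenation, the convolution product of
  \<open>w3_word \<Rightarrow>\<^sub>0 complex\<close> is the product of the free associative algebra.\<close>

type_synonym w3_free = "w3_word \<Rightarrow>\<^sub>0 complex"

definition const :: "complex \<Rightarrow> w3_free" where "const a = Poly_Mapping.single 0 a"

definition gL :: "int \<Rightarrow> w3_free" where "gL m = Poly_Mapping.single (Word [GenL m]) 1"

definition gW :: "int \<Rightarrow> w3_free" where "gW m = Poly_Mapping.single (Word [GenW m]) 1"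

text \<open>\<open>\<Lambda>\<^sub>m\<close> without those summands whose right factor is some \<open>L\<^sub>j\<close> with \<open>j > N\<close>.
  On a vector killed by all such \<open>L\<^sub>j\<close> this is the full (infinite) sum.\<close>

definition Lam_upto :: "int \<Rightarrow> int \<Rightarrow> w3_free" where
  "Lam_upto N m =
     (\<Sum>j\<in>{2..N - m}. gL (- j) * gL (m + j)) + (\<Sum>j\<in>{-1..N}. gL (m - j) * gL j)
     - const (3 / 10 * (of_int m + 2) * (of_int m + 3)) * gL m"


section \<open>Verma modules and their irreducible quotients\<close>

text \<open>\<open>\<M>(c,\<lambda>,\<mu>)\<close> is the free algebra modulo the left ideal below, with \<open>\<one>\<^bsub>\<lambda>,\<mu>\<^esub>\<close>
  the class of \<open>1\<close>. The defining relations of the algebra are imposed on every vector. In \<open>WW\<close>,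
  the premise says that \<open>L\<^sub>j\<close> kills the class of \<open>t\<close> for \<open>j > N\<close>. It is no restriction: a suitable
  \<open>N\<close> exists for every \<open>t\<close>, by induction on words using the relations themselves, and the relation
  obtained does not depend on the choice of \<open>N\<close>. The definition is only meaningful
  for \<open>22 + 5c \<noteq> 0\<close>.\<close>

inductive_set verma_ideal :: "complex \<Rightarrow> complex \<Rightarrow> complex \<Rightarrow> w3_free set"
  for c lam mu :: complex
where
  zero: "0 \<in> verma_ideal c lam mu"
| add: "\<lbrakk>s \<in> verma_ideal c lam mu; t \<in> verma_ideal c lam mu\<rbrakk> \<Longrightarrow> s + t \<in> verma_ideal c lam mu"
| lmult: "t \<in> verma_ideal c lam mu \<Longrightarrow> a * t \<in> verma_ideal c lam mu"
| hw_L: "m > 0 \<Longrightarrow> gL m \<in> verma_ideal c lam mu"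
| hw_W: "m > 0 \<Longrightarrow> gW m \<in> verma_ideal c lam mu"
| hw_L0: "gL 0 - const lam \<in> verma_ideal c lam mu"
| hw_W0: "gW 0 - const mu \<in> verma_ideal c lam mu"
| LL: "(gL m * gL n - gL n * gL m
        - (const (of_int (m - n)) * gL (m + n)
           + const (if m + n = 0 then (of_int m ^ 3 - of_int m) / 12 * c else 0))) * t
       \<in> verma_ideal c lam mu"
| LW: "(gL m * gW n - gW n * gL m - const (of_int (2 * m - n)) * gW (m + n)) * t
       \<in> verma_ideal c lam mu"
| WW: "(\<And>j. j > N \<Longrightarrow> gL j * t \<in> verma_ideal c lam mu) \<Longrightarrow>
       (gW m * gW n - gW n * gW m
        - (const (of_int (m - n) *
             (1 / 15 * (of_int m + of_int n + 2) * (of_int m + of_int n + 3)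
              - 1 / 6 * (of_int m + 2) * (of_int n + 2))) * gL (m + n)
           + const (16 / (22 + 5 * c) * of_int (m - n)) * Lam_upto N (m + n)
           + const (if m + n = 0
               then of_int m * (of_int m ^ 2 - 1) * (of_int m ^ 2 - 4) / 360 * c else 0))) * t
       \<in> verma_ideal c lam mu"

text \<open>A vector space with operators \<open>L m\<close>, \<open>W m\<close> and a vector \<open>one\<close> is a realization of the
  irreducible quotient \<open>\<L>(c,\<lambda>,\<mu>)\<close>. The map \<open>p\<close> is the composition of the free algebra's
  projection onto \<open>\<M>(c,\<lambda>,\<mu>)\<close> with the module projection from there.\<close>

locale w3_irreducible_quotient = vector_space scale
  for scale :: "complex \<Rightarrow> 'v::ab_group_add \<Rightarrow> 'v" (infixr \<open>*s\<close> 75) +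
  fixes c lam mu :: complex
    and L W :: "int \<Rightarrow> 'v \<Rightarrow> 'v"
    and one :: 'v
  assumes quotient_of_verma:
    "\<exists>p :: w3_free \<Rightarrow> 'v.
       surj p \<and> p 1 = one \<and>
       (\<forall>s t. p (s + t) = p s + p t) \<and>
       (\<forall>a t. p (const a * t) = a *s p t) \<and>
       (\<forall>m t. p (gL m * t) = L m (p t)) \<and>
       (\<forall>m t. p (gW m * t) = W m (p t)) \<and>
       (\<forall>t \<in> verma_ideal c lam mu. p t = 0)"
    and nontrivial: "\<exists>v :: 'v. v \<noteq> 0"
    and irreducible:
    "\<lbrakk>subspace N; \<And>m v. v \<in> N \<Longrightarrow> L m v \<in> N; \<And>m v. v \<in> N \<Longrightarrow> W m v \<in> N\<rbrakk>
     \<Longrightarrow> N = {0} \<or> N = UNIV"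


section \<open>Vertex operator algebras\<close>

text \<open>\<open>Y a n\<close> is the mode \<open>a\<^sub>n\<close> in \<open>Y(a,z) = \<Sum>\<^sub>n a\<^sub>n z\<^bsup>-n-1\<^esup>\<close>. The Jacobi identity is stated in
  components (Borcherds identity); by truncation both sums have finite support.\<close>

locale vertex_algebra = vector_space scale
  for scale :: "complex \<Rightarrow> 'v::ab_group_add \<Rightarrow> 'v" (infixr \<open>*s\<close> 75) +
  fixes Y :: "'v \<Rightarrow> int \<Rightarrow> 'v \<Rightarrow> 'v"
    and vac :: 'v
  assumes Y_add_left: "Y (a + b) n v = Y a n v + Y b n v"
    and Y_scale_left: "Y (r *s a) n v = r *s Y a n v"
    and Y_add_right: "Y a n (u + v) = Y a n u + Y a n v"
    and Y_scale_right: "Y a n (r *s v) = r *s Y a n v"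
    and truncation: "\<exists>N. \<forall>n\<ge>N. Y a n v = 0"
    and vacuum: "Y vac n v = (if n = -1 then v else 0)"
    and creation: "n \<ge> 0 \<Longrightarrow> Y a n vac = 0" "Y a (-1) vac = a"
    and borcherds:
    "Sum_any (\<lambda>i::nat. (of_int m gchoose i) *s Y (Y a (n + int i) b) (m + k - int i) v)
     = Sum_any (\<lambda>i::nat. ((-1) ^ i * (of_int n gchoose i)) *s
         (Y a (m + n - int i) (Y b (k + int i) v)
          - ((-1) powi n) *s Y b (n + k - int i) (Y a (m + int i) v)))"
begin

text \<open>The vertex subalgebra generated by a set \<open>S\<close> of states.\<close>

inductive_set generated_subalgebra :: "'v set \<Rightarrow> 'v set" for S :: "'v set" where
  base: "a \<in> S \<Longrightarrow> a \<in> generated_subalgebra S"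
| zero: "0 \<in> generated_subalgebra S"
| vac: "vac \<in> generated_subalgebra S"
| add: "\<lbrakk>a \<in> generated_subalgebra S; b \<in> generated_subalgebra S\<rbrakk> \<Longrightarrow> a + b \<in> generated_subalgebra S"
| scale: "a \<in> generated_subalgebra S \<Longrightarrow> r *s a \<in> generated_subalgebra S"
| mode: "\<lbrakk>a \<in> generated_subalgebra S; b \<in> generated_subalgebra S\<rbrakk> \<Longrightarrow> Y a n b \<in> generated_subalgebra S"

text \<open>Below, the whole space is regarded as a module over a vertex subalgebra \<open>U\<close>, by restricting
  \<open>Y\<close> to \<open>U\<close>.\<close>

definition submodule :: "'v set \<Rightarrow> 'v set \<Rightarrow> bool" where
  "submodule U N \<longleftrightarrow> subspace N \<and> (\<forall>a\<in>U. \<forall>n. \<forall>v\<in>N. Y a n v \<in> N)"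

definition irreducible_submodule :: "'v set \<Rightarrow> 'v set \<Rightarrow> bool" where
  "irreducible_submodule U N \<longleftrightarrow>
     submodule U N \<and> N \<noteq> {0} \<and> (\<forall>K. submodule U K \<and> K \<subseteq> N \<longrightarrow> K = {0} \<or> K = N)"

text \<open>The space is the direct sum of a family of irreducible \<open>U\<close>-submodules.\<close>

definition completely_reducible :: "'v set \<Rightarrow> bool" where
  "completely_reducible U \<longleftrightarrow>
     (\<exists>F. (\<forall>N\<in>F. irreducible_submodule U N) \<and> span (\<Union>F) = UNIV \<and>
          (\<forall>N\<in>F. N \<inter> span (\<Union>(F - {N})) = {0}))"

end

locale vertex_operator_algebra = vertex_algebra scale Y vac
  for scale :: "complex \<Rightarrow> 'v::ab_group_add \<Rightarrow> 'v" (infixr \<open>*s\<close> 75)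
    and Y :: "'v \<Rightarrow> int \<Rightarrow> 'v \<Rightarrow> 'v"
    and vac :: 'v +
  fixes omega :: 'v
    and rank :: complex
  assumes virasoro:
    "Y omega (m + 1) (Y omega (n + 1) v) - Y omega (n + 1) (Y omega (m + 1) v)
     = of_int (m - n) *s Y omega (m + n + 1) v
       + (if m + n = 0 then (of_int m ^ 3 - of_int m) / 12 * rank else 0) *s v"
    and translation: "Y (Y omega 0 a) n v = (- of_int n) *s Y a (n - 1) v"
    and grading_span: "span (\<Union>k::int. {v. Y omega 1 v = of_int k *s v}) = UNIV"
    and grading_finite:
    "\<exists>B. finite B \<and> {v. Y omega 1 v = of_int k *s v} \<subseteq> span B"
    and grading_bounded:
    "\<exists>k0. \<forall>k<k0. {v. Y omega 1 v = of_int k *s v} = {0}"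

end

theory Submission
  imports Defs
begin

text \<open>
  Let \<open>v\<close> be a Virasoro primary vector of weight \<open>9 = 3\<^sup>2\<close> with leading term
  \<open>W\<^sub>-\<^sub>3W\<^sub>-\<^sub>3W\<^sub>-\<^sub>3\<one>\<close>. The Virasoro Verma module of highest weight \<open>9\<close> at central charge \<open>1\<close>
  has a singular vector \<open>S\<close> of weight \<open>16\<close>. In a completely reducible module the components of \<open>v\<close>
  in the irreducible summands are again primary of weight \<open>9\<close>; as a nonzero \<open>S v\<close> would generate a
  proper submodule of such a summand, \<open>S v = 0\<close>. On the other hand \<open>W\<^sub>n v = 0\<close> for \<open>n > 3\<close> and
  \<open>W\<^sub>3 v \<noteq> 0\<close>, and \<open>W\<^sub>1\<^sub>0 S v\<close> is a nonzero multiple of \<open>W\<^sub>3 v\<close>.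
\<close>

no_notation vector_scalar_mult (infixl \<open>*s\<close> 70)

section \<open>The relations on the irreducible quotient\<close>

lemma const_0 [simp]: "const 0 = 0"
  by (simp add: const_def)

lemma const_uminus_one: "const (-1) * t = - t"
  by (simp add: const_def single_uminus)

lemma gen_const_commute:
  "gL m * (const a * t) = const a * (gL m * t)" "gW m * (const a * t) = const a * (gW m * t)"
  by (simp_all add: const_def gL_def gW_def mult_single flip: mult.assoc)

lemma w3_free_induct [case_names one add scale L W]:
  assumes one: "P 1"
    and add: "\<And>s t. P s \<Longrightarrow> P t \<Longrightarrow> P (s + t)"
    and scale: "\<And>a t. P t \<Longrightarrow> P (const a * t)"
    and L: "\<And>n t. P t \<Longrightarrow> P (gL n * t)"
    and W: "\<And>n t. P t \<Longrightarrow> P (gW n * t)"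
  shows "P t"
proof -
  have word: "P (Poly_Mapping.single (Word gs) 1)" for gs
  proof (induction gs)
    case Nil
    then show ?case
      using one by (simp flip: zero_w3_word_def)
  next
    case (Cons g gs)
    have "Poly_Mapping.single (Word (g # gs)) 1
        = Poly_Mapping.single (Word [g]) 1 * (Poly_Mapping.single (Word gs) 1 :: w3_free)"
      by (simp add: mult_single plus_w3_word_def)
    then show ?case
      using L[OF Cons] W[OF Cons] by (cases g) (simp_all add: gL_def gW_def)
  qed
  have mono: "P (Poly_Mapping.single u a)" for u a
    using scale[OF word[of "letters u"], of a] by (simp add: const_def mult_single)
  show ?thesis
  proof (induction t rule: update_induct)
    case const
    then show ?case
      using scale[OF one, of 0] by simp
  next
    case (update f u a)
    have "Poly_Mapping.update u a f = f + Poly_Mapping.single u a"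
      using update(1) by (intro poly_mapping_eqI)
        (auto simp: lookup_update lookup_add lookup_single in_keys_iff)
    then show ?case
      using add[OF update(3) mono] by simp
  qed
qed

section \<open>Local nilpotency in the Verma module\<close>

context
  fixes c lam mu :: complex
begin

text \<open>Needed to discharge the premise of \<open>verma_ideal.WW\<close>. That premise mentions
  only the \<open>gL j\<close>, but moving \<open>gL j\<close> past \<open>gW n\<close> leaves a
  term in \<open>gW (j + n)\<close>, so both kinds go through the induction together.\<close>

abbreviation locally_nilpotent :: "w3_free \<Rightarrow> bool" where
  "locally_nilpotent t \<equiv>
     \<exists>N. \<forall>j>N. gL j * t \<in> verma_ideal c lam mu \<and> gW j * t \<in> verma_ideal c lam mu"

lemma verma_ideal_diff:
  "s \<in> verma_ideal c lam mu \<Longrightarrow> t \<in> verma_ideal c lam mu \<Longrightarrow> s - t \<in> verma_ideal c lam mu"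
  using verma_ideal.add[of s c lam mu "const (-1) * t"] verma_ideal.lmult[of t c lam mu "const (-1)"]
  by (simp add: const_uminus_one)

lemmas verma_ideal_lmult = verma_ideal.lmult[of "s * t" c lam mu a for s t a]

lemma verma_ideal_sum:
  "(\<And>i. i \<in> A \<Longrightarrow> f i \<in> verma_ideal c lam mu) \<Longrightarrow> sum f A \<in> verma_ideal c lam mu"
  by (induction A rule: infinite_finite_induct) (auto intro: verma_ideal.zero verma_ideal.add)

lemma locally_nilpotent_L:
  assumes "locally_nilpotent t"
  shows "locally_nilpotent (gL n * t)"
proof -
  obtain N where
    N: "\<And>j. j > N \<Longrightarrow> gL j * t \<in> verma_ideal c lam mu" "\<And>j. j > N \<Longrightarrow> gW j * t \<in> verma_ideal c lam mu"
    using assms by auto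
  \<comment> \<open>The entry \<open>- n\<close> of the bound keeps \<open>j + n\<close> positive,
    so the central term is absent.\<close>
  have "gL j * (gL n * t) \<in> verma_ideal c lam mu" if j: "j > max (- n) (max N (N - n))" for j
  proof -
    have "(gL j * gL n - gL n * gL j - (const (of_int (j - n)) * gL (j + n) + const 0)) * t
        + (gL n * (gL j * t) + const (of_int (j - n)) * (gL (j + n) * t)) \<in> verma_ideal c lam mu"
      using verma_ideal.LL[of j n c t lam mu] j N
      by (intro verma_ideal.add verma_ideal_lmult) auto
    then show ?thesis
      by (simp add: algebra_simps)
  qed
  moreover have "gW j * (gL n * t) \<in> verma_ideal c lam mu" if j: "j > max N (N - n)" for j
  proof -
    have "gL n * (gW j * t) - const (of_int (2 * n - j)) * (gW (n + j) * t)
        - (gL n * gW j - gW j * gL n - const (of_int (2 * n - j)) * gW (n + j)) * t \<in> verma_ideal c lam mu"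
      using j N by (intro verma_ideal_diff verma_ideal_lmult verma_ideal.LW) auto
    then show ?thesis
      by (simp add: algebra_simps)
  qed
  ultimately show ?thesis
    by (intro exI[of _ "max (- n) (max N (N - n))"]) simp
qed

lemma locally_nilpotent_W:
  assumes "locally_nilpotent t"
  shows "locally_nilpotent (gW n * t)"
proof -
  obtain N where
    N: "\<And>j. j > N \<Longrightarrow> gL j * t \<in> verma_ideal c lam mu" "\<And>j. j > N \<Longrightarrow> gW j * t \<in> verma_ideal c lam mu"
    using assms by auto
  obtain f where f: "\<And>i j. j > f i \<Longrightarrow> gL j * (gL i * t) \<in> verma_ideal c lam mu"
    using locally_nilpotent_L[OF assms] by metis
  \<comment> \<open>The second sum of \<open>Lam_upto\<close> has only the right factors
    \<open>gL i\<close> with \<open>i\<close> in \<open>{-1..N}\<close>, so one \<open>M\<close>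
    serves them all. For \<open>j > B\<close> the first sum is empty, each left factor of the second
    sum has index above \<open>M\<close>, and the central term vanishes.\<close>
  define M where "M = Max (insert 0 (f ` {-1..N}))"
  have M: "f i \<le> M" if "i \<in> {-1..N}" for i
    unfolding M_def using that by (intro Max_ge) auto
  define B where "B = \<bar>N\<bar> + \<bar>n\<bar> + M"
  have "M \<ge> 0"
    unfolding M_def by (intro Max_ge) auto
  then have B: "j > N" "j + n > N" "j + n > M + N" "j + n \<noteq> 0" if "j > B" for j
    using that by (auto simp: B_def)
  have Lam: "Lam_upto N (j + n) * t \<in> verma_ideal c lam mu" if j: "j > B" for j
  proof -
    have "gL (- i) * (gL (j + n + i) * t) \<in> verma_ideal c lam mu" if "i \<in> {2..N - (j + n)}" for i
      using that B(2)[OF j] by (intro verma_ideal_lmult N) auto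
    moreover have "gL (j + n - i) * (gL i * t) \<in> verma_ideal c lam mu" if "i \<in> {-1..N}" for i
      using that M[OF that] B(3)[OF j] by (intro f) auto
    moreover have "gL (j + n) * t \<in> verma_ideal c lam mu"
      using B(2)[OF j] N by simp
    ultimately show ?thesis
      unfolding Lam_upto_def left_diff_distrib distrib_right sum_distrib_right mult.assoc
      by (intro verma_ideal_diff verma_ideal.add verma_ideal_sum verma_ideal_lmult[where a = "const _"])
  qed
  have "gL j * (gW n * t) \<in> verma_ideal c lam mu" if j: "j > B" for j
  proof -
    have "(gL j * gW n - gW n * gL j - const (of_int (2 * j - n)) * gW (j + n)) * t
        + gW n * (gL j * t) + const (of_int (2 * j - n)) * (gW (j + n) * t) \<in> verma_ideal c lam mu"
      using B[OF j] N by (intro verma_ideal.add verma_ideal_lmult verma_ideal.LW) auto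
    then show ?thesis
      by (simp add: algebra_simps)
  qed
  moreover have "gW j * (gW n * t) \<in> verma_ideal c lam mu" if j: "j > B" for j
  proof -
    define a b where "a = const (of_int (j - n) *
             (1 / 15 * (of_int j + of_int n + 2) * (of_int j + of_int n + 3)
              - 1 / 6 * (of_int j + 2) * (of_int n + 2)))"
      and "b = const (16 / (22 + 5 * c) * of_int (j - n))"
    have "(gW j * gW n - gW n * gW j - (a * gL (j + n) + b * Lam_upto N (j + n) + const 0)) * t
        \<in> verma_ideal c lam mu"
      using verma_ideal.WW[of N t c lam mu j n] B(4)[OF j] N unfolding a_def b_def by simp
    then have "(gW j * gW n - gW n * gW j - (a * gL (j + n) + b * Lam_upto N (j + n) + const 0)) * t
        + gW n * (gW j * t) + a * (gL (j + n) * t) + b * (Lam_upto N (j + n) * t) \<in> verma_ideal c lam mu"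
      using B[OF j] N Lam[OF j] by (intro verma_ideal.add verma_ideal_lmult) auto
    then show ?thesis
      by (simp add: algebra_simps)
  qed
  ultimately show ?thesis
    by (intro exI[of _ B]) simp
qed

lemma verma_locally_nilpotent: "locally_nilpotent t"
proof (induction t rule: w3_free_induct)
  case one
  show ?case
    by (rule exI[of _ 0]) (simp add: verma_ideal.hw_L verma_ideal.hw_W)
next
  case (add s t)
  then obtain M N where
    "\<forall>j>M. gL j * s \<in> verma_ideal c lam mu \<and> gW j * s \<in> verma_ideal c lam mu"
    "\<forall>j>N. gL j * t \<in> verma_ideal c lam mu \<and> gW j * t \<in> verma_ideal c lam mu"
    by auto
  then show ?case
    by (intro exI[of _ "max M N"]) (simp add: distrib_left verma_ideal.add)
next
  case (scale a t)
  then show ?case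
    by (auto simp: gen_const_commute intro: verma_ideal.lmult)
qed (fact locally_nilpotent_L locally_nilpotent_W)+

end

section \<open>Operators and commutators on the quotient\<close>

context w3_irreducible_quotient
begin

definition proj :: "w3_free \<Rightarrow> 'v" where
  "proj = (SOME p. surj p \<and> p 1 = one \<and>
       (\<forall>s t. p (s + t) = p s + p t) \<and>
       (\<forall>a t. p (const a * t) = a *s p t) \<and>
       (\<forall>m t. p (gL m * t) = L m (p t)) \<and>
       (\<forall>m t. p (gW m * t) = W m (p t)) \<and>
       (\<forall>t \<in> verma_ideal c lam mu. p t = 0))"

lemma surj_proj: "surj proj"
  and proj_one: "proj 1 = one"
  and proj_add: "proj (s + t) = proj s + proj t"
  and proj_const: "proj (const a * t) = a *s proj t"
  and proj_L: "proj (gL m * t) = L m (proj t)"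
  and proj_W: "proj (gW m * t) = W m (proj t)"
  and proj_ideal: "t \<in> verma_ideal c lam mu \<Longrightarrow> proj t = 0"
  using someI_ex[OF quotient_of_verma] unfolding proj_def[symmetric] by simp_all

lemma proj_0: "proj 0 = 0"
  using proj_const[of 0 0] by simp

lemma proj_diff: "proj (s - t) = proj s - proj t"
  using proj_add[of s "const (-1) * t"] proj_const[of "-1" t]
  by (simp add: const_uminus_one)

lemma proj_sum: "proj (sum f A) = (\<Sum>i\<in>A. proj (f i))"
  by (induction A rule: infinite_finite_induct) (simp_all add: proj_0 proj_add)

lemmas proj_simps = proj_add proj_diff proj_const proj_L proj_W proj_sum proj_one

lemma proj_cases: obtains t where "x = proj t"
  using surj_proj by (metis surjE)

fun act :: "w3_gen \<Rightarrow> 'v \<Rightarrow> 'v" where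
  "act (GenL m) = L m"
| "act (GenW m) = W m"

lemma act_add: "act g (x + y) = act g x + act g y"
  by (cases g; rule proj_cases[of x]; rule proj_cases[of y])
    (simp_all add: distrib_left flip: proj_L proj_W proj_add)

lemma act_scale: "act g (a *s x) = a *s act g x"
  by (cases g; rule proj_cases[of x])
    (simp_all add: gen_const_commute flip: proj_L proj_W proj_const)

lemma act_zero: "act g 0 = 0"
  using act_scale[of g 0 0] by simp

lemma act_sum: "act g (sum f A) = (\<Sum>i\<in>A. act g (f i))"
  by (induction A rule: infinite_finite_induct) (simp_all add: act_zero act_add)

lemmas L_add = act_add[of "GenL m" for m, simplified]
lemmas L_scale = act_scale[of "GenL m" for m, simplified]
lemmas L_zero = act_zero[of "GenL m" for m, simplified]
lemmas L_sum = act_sum[of "GenL m" for m, simplified]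
lemmas W_zero = act_zero[of "GenW m" for m, simplified]

lemma L_one: "m > 0 \<Longrightarrow> L m one = 0"
  using proj_ideal[OF verma_ideal.hw_L] proj_L[of m 1] by (simp add: proj_one)

lemma W_one: "m > 0 \<Longrightarrow> W m one = 0"
  using proj_ideal[OF verma_ideal.hw_W] proj_W[of m 1] by (simp add: proj_one)

lemma L0_one: "L 0 one = lam *s one"
  using proj_ideal[OF verma_ideal.hw_L0] proj_L[of 0 1] proj_const[of lam 1]
  by (simp add: proj_one proj_diff)

lemma W0_one: "W 0 one = mu *s one"
  using proj_ideal[OF verma_ideal.hw_W0] proj_W[of 0 1] proj_const[of mu 1]
  by (simp add: proj_one proj_diff)

lemma L_L:
  "L m (L n x) = L n (L m x) + (of_int (m - n) *s L (m + n) x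
     + (if m + n = 0 then (of_int m ^ 3 - of_int m) / 12 * c else 0) *s x)"
proof (rule proj_cases[of x])
  fix t assume t: "x = proj t"
  show ?thesis
    using proj_ideal[OF verma_ideal.LL[of m n c t lam mu]]
    unfolding left_diff_distrib distrib_right mult.assoc proj_simps t[symmetric]
    by (simp add: algebra_simps)
qed

lemma L_W: "L m (W n x) = W n (L m x) + of_int (2 * m - n) *s W (m + n) x"
proof (rule proj_cases[of x])
  fix t assume t: "x = proj t"
  show ?thesis
    using proj_ideal[OF verma_ideal.LW[of m n t c lam mu]]
    unfolding left_diff_distrib distrib_right mult.assoc proj_simps t[symmetric]
    by (simp add: algebra_simps)
qed

lemma W_L: "W m (L n x) = L n (W m x) + of_int (m - 2 * n) *s W (m + n) x"
  using L_W[of n m x] by (simp add: algebra_simps)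

definition Lam :: "int \<Rightarrow> int \<Rightarrow> 'v \<Rightarrow> 'v" where
  "Lam N m x = (\<Sum>j\<in>{2..N - m}. L (- j) (L (m + j) x)) + (\<Sum>j\<in>{-1..N}. L (m - j) (L j x))
     - (3 / 10 * (of_int m + 2) * (of_int m + 3)) *s L m x"

lemma proj_Lam: "proj (Lam_upto N m * t) = Lam N m (proj t)"
  unfolding Lam_upto_def Lam_def left_diff_distrib distrib_right sum_distrib_right mult.assoc proj_simps
  by simp

text \<open>The summands beyond \<open>N\<close> end in an \<open>L j\<close> that kills
  \<open>x\<close>. This frees \<open>W_W\<close> from the bound that belongs to one preimage of
  \<open>x\<close>.\<close>

lemma Lam_cong:
  assumes "\<And>j. j > N \<Longrightarrow> L j x = 0" and "N \<le> M"
  shows "Lam M m x = Lam N m x"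
proof -
  have "(\<Sum>j\<in>{2..M - m}. L (- j) (L (m + j) x)) = (\<Sum>j\<in>{2..N - m}. L (- j) (L (m + j) x))"
    using assms by (intro sum.mono_neutral_right) (auto simp: L_zero)
  moreover have "(\<Sum>j\<in>{-1..M}. L (m - j) (L j x)) = (\<Sum>j\<in>{-1..N}. L (m - j) (L j x))"
    using assms by (intro sum.mono_neutral_right) (auto simp: L_zero)
  ultimately show ?thesis
    by (simp add: Lam_def)
qed

lemma W_W:
  assumes "\<And>j. j > N \<Longrightarrow> L j x = 0"
  shows "W m (W n x) = W n (W m x)
    + ((of_int (m - n) *
         (1 / 15 * (of_int m + of_int n + 2) * (of_int m + of_int n + 3)
          - 1 / 6 * (of_int m + 2) * (of_int n + 2))) *s L (m + n) x
       + (16 / (22 + 5 * c) * of_int (m - n)) *s Lam N (m + n) x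
       + (if m + n = 0
          then of_int m * (of_int m ^ 2 - 1) * (of_int m ^ 2 - 4) / 360 * c else 0) *s x)"
proof (rule proj_cases[of x])
  fix t assume t: "x = proj t"
  \<comment> \<open>\<open>L j x = 0\<close> does not put \<open>gL j * t\<close> into the ideal, as
    \<open>proj\<close> may kill more. The bound for the ideal relation therefore comes from
    \<open>t\<close>, and \<open>Lam_cong\<close> brings it back to \<open>N\<close>.\<close>
  obtain K where K: "\<And>j. j > K \<Longrightarrow> gL j * t \<in> verma_ideal c lam mu"
    using verma_locally_nilpotent by metis
  have "Lam (max K N) (m + n) x = Lam N (m + n) x"
    using assms by (intro Lam_cong) auto
  then show ?thesis
    using proj_ideal[OF verma_ideal.WW[of "max K N" t c lam mu m n]] K
    unfolding left_diff_distrib distrib_right mult.assoc proj_simps proj_Lam t[symmetric]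
    by (simp add: algebra_simps)
qed

end

section \<open>Weights\<close>

fun mode :: "w3_gen \<Rightarrow> int" where
  "mode (GenL n) = n"
| "mode (GenW n) = n"

context w3_irreducible_quotient
begin

section \<open>Spanning by products of lowering operators\<close>

lemma act_span:
  assumes "x \<in> span B" and "\<And>b. b \<in> B \<Longrightarrow> act g b \<in> span S"
  shows "act g x \<in> span S"
  using assms(1)
  by (induction rule: span_induct_alt)
    (simp_all add: act_zero act_add act_scale span_zero span_add span_scale assms(2))

lemma eventually_L_zero: "\<exists>N. \<forall>j>N. L j x = 0"
proof (rule proj_cases[of x])
  fix t assume t: "x = proj t"
  show ?thesis
    using verma_locally_nilpotent[of t c lam mu] proj_ideal unfolding t proj_L[symmetric] by blast
qed

text \<open>\<open>lowered_span d\<close> is filtered by the number \<open>d\<close> of lowering operators because a commutator of two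
  \<open>W\<close>'s is quadratic in the \<open>L\<close>'s: it maps \<open>lowered_span d\<close> to \<open>lowered_span (d + 2)\<close> only.\<close>

inductive lowered :: "nat \<Rightarrow> int \<Rightarrow> 'v \<Rightarrow> bool" where
  one: "lowered d 0 one"
| step: "lowered d k x \<Longrightarrow> mode g < 0 \<Longrightarrow> lowered (Suc d) (k - mode g) (act g x)"

definition lowered_span :: "nat \<Rightarrow> 'v set" where
  "lowered_span d = span {x. \<exists>k. lowered d k x}"

lemma lowered_Suc: "lowered d k x \<Longrightarrow> lowered (Suc d) k x"
  by (induction rule: lowered.induct) (auto intro: lowered.intros)

lemma lowered_span_mono: "x \<in> lowered_span d \<Longrightarrow> x \<in> lowered_span (Suc d)"
  using span_mono[of "{x. \<exists>k. lowered d k x}" "{x. \<exists>k. lowered (Suc d) k x}"] lowered_Suc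
  unfolding lowered_span_def by blast

lemma lowered_span_neg:
  "x \<in> lowered_span d \<Longrightarrow> mode g < 0 \<Longrightarrow> act g x \<in> lowered_span (Suc d)"
  unfolding lowered_span_def
  by (erule act_span) (auto intro!: span_base lowered.step)

lemma lowered_span_base: "lowered d k x \<Longrightarrow> x \<in> lowered_span d"
  unfolding lowered_span_def by (auto intro: span_base)

lemma lowered_span_actI:
  assumes "x \<in> lowered_span d" and "\<And>k b. lowered d k b \<Longrightarrow> act g b \<in> lowered_span e"
  shows "act g x \<in> lowered_span e"
  using assms unfolding lowered_span_def by (auto intro: act_span)

lemma subspace_lowered_span: "subspace (lowered_span d)"
  unfolding lowered_span_def by (rule subspace_span)

lemmas lowered_span_intros =
  subspace_add[OF subspace_lowered_span] subspace_scale[OF subspace_lowered_span]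
  subspace_diff[OF subspace_lowered_span] subspace_sum[OF subspace_lowered_span]
  subspace_0[OF subspace_lowered_span]

text \<open>The operator is moved past the outermost lowering operator. For \<open>L m\<close> the
  commutators are linear and the degree stays. For \<open>W m\<close> the term \<open>Lam\<close>
  applies two \<open>L\<close>'s to a vector of degree \<open>d\<close>; its bound
  \<open>anyL2\<close> rests on the claim for \<open>L\<close> at degree \<open>Suc d\<close>, so
  \<open>posL\<close> comes first.\<close>

lemma lowered_span_nonneg:
  assumes "m \<ge> 0" "x \<in> lowered_span d"
  shows "L m x \<in> lowered_span d \<and> W m x \<in> lowered_span (Suc d)"
  using assms
proof (induction d arbitrary: m x)
  case 0
  have "L m b \<in> lowered_span 0 \<and> W m b \<in> lowered_span (Suc 0)" if b: "lowered 0 k b" for k b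
  proof -
    have "b = one"
      using b by (cases rule: lowered.cases) auto
    moreover have "one \<in> lowered_span d" for d
      using lowered_span_base lowered.one by blast
    moreover have "m = 0 \<or> m > 0"
      using 0 by auto
    ultimately show ?thesis
      by (auto simp: L_one W_one L0_one W0_one intro!: lowered_span_intros)
  qed
  then show ?case
    using lowered_span_actI[OF 0(2), of "GenL m" 0] lowered_span_actI[OF 0(2), of "GenW m" "Suc 0"] by simp
next
  case (Suc d)
  have oneI: "one \<in> lowered_span d" for d
    using lowered_span_base lowered.one by blast
  have anyL: "L a y \<in> lowered_span (Suc d)" and anyW: "W a y \<in> lowered_span (Suc d)"
    if "y \<in> lowered_span d" for a y
    using Suc.IH[of a y] lowered_span_neg[of y d "GenL a"] lowered_span_neg[of y d "GenW a"]
      lowered_span_mono[of "L a y"] that by (cases "a < 0"; simp)+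
  have posL: "L a y \<in> lowered_span (Suc d)" if a: "a \<ge> 0" and y: "y \<in> lowered_span (Suc d)" for a y
  proof -
    have "act (GenL a) b \<in> lowered_span (Suc d)" if b: "lowered (Suc d) k b" for k b
      using b
    proof (cases rule: lowered.cases)
      case one
      then show ?thesis
        using a oneI by (cases "a = 0") (auto simp: L_one L0_one intro: lowered_span_intros)
    next
      case (step k' z g)
      have z: "z \<in> lowered_span d"
        using step lowered_span_base by blast
      have "act g (L a z) \<in> lowered_span (Suc d)"
        using lowered_span_neg[of "L a z" d g] Suc.IH[OF a z] step by simp
      then show ?thesis
        using anyL[OF z] anyW[OF z] lowered_span_mono[OF z] step
        by (cases g) (auto simp: L_L[of a] L_W[of a] intro!: lowered_span_intros)
    qed
    then show ?thesis
      using lowered_span_actI[OF y, of "GenL a"] by simp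
  qed
  have anyL2: "L a y \<in> lowered_span (Suc (Suc d))" if "y \<in> lowered_span (Suc d)" for a y
    using posL[of a y] lowered_span_neg[of y "Suc d" "GenL a"] lowered_span_mono[of "L a y"] that
    by (cases "a < 0") auto
  have Lam: "Lam N a y \<in> lowered_span (Suc (Suc d))" if "y \<in> lowered_span d" for N a y
    unfolding Lam_def using anyL2 anyL[OF that] lowered_span_mono by (intro lowered_span_intros) auto
  have "act (GenW m) b \<in> lowered_span (Suc (Suc d))" if b: "lowered (Suc d) k b" for k b
    using b
  proof (cases rule: lowered.cases)
    case one
    then show ?thesis
      using Suc.prems(1) oneI by (cases "m = 0") (auto simp: W_one W0_one intro: lowered_span_intros)
  next
    case (step k' z g)
    have z: "z \<in> lowered_span d"
      using step lowered_span_base by blast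
    obtain N where N: "\<And>j. j > N \<Longrightarrow> L j z = 0"
      using eventually_L_zero by blast
    have "act g (W m z) \<in> lowered_span (Suc (Suc d))"
      using lowered_span_neg[of "W m z" "Suc d" g] Suc.IH[OF Suc.prems(1) z] step by simp
    then show ?thesis
      using anyL[OF z] anyW[OF z] z Lam[OF z] lowered_span_mono step N
      by (cases g) (auto simp: W_L[of m] W_W[of N z m] intro!: lowered_span_intros)
  qed
  then show ?case
    using posL[OF Suc.prems] lowered_span_actI[OF Suc.prems(2), of "GenW m"] by simp
qed

lemma lowered_span_act: "x \<in> lowered_span d \<Longrightarrow> act g x \<in> lowered_span (Suc d)"
  using lowered_span_neg[of x d g] lowered_span_nonneg[of "mode g" x d] lowered_span_mono[of "act g x" d]
  by (cases g; cases "mode g < 0") auto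

text \<open>The filtration contains the highest weight vector, and each generator raises its degree
  by at most one. No ordering of the factors is claimed: only the weights of the words matter
  later.\<close>

lemma lowered_span_exhausts: "\<exists>d. x \<in> lowered_span d"
proof -
  have mono: "x \<in> lowered_span d \<Longrightarrow> x \<in> lowered_span (e + d)" for x d e
    by (induction e) (auto intro: lowered_span_mono)
  have "\<exists>d. proj t \<in> lowered_span d" for t
  proof (induction t rule: w3_free_induct)
    case one
    then show ?case
      using lowered_span_base[OF lowered.one] by (auto simp: proj_one)
  next
    case (add s t)
    then obtain d e where "proj s \<in> lowered_span d" "proj t \<in> lowered_span e"
      by auto
    then show ?case
      using mono[of "proj s" d e] mono[of "proj t" e d]
      by (auto simp: proj_add add.commute intro!: exI[of _ "d + e"] lowered_span_intros)
  next
    case (scale a t)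
    then show ?case
      by (auto simp: proj_const intro: lowered_span_intros)
  next
    case (L n t)
    then show ?case
      using lowered_span_act[of "proj t" _ "GenL n"] by (auto simp: proj_L)
  next
    case (W n t)
    then show ?case
      using lowered_span_act[of "proj t" _ "GenW n"] by (auto simp: proj_W)
  qed
  then show ?thesis
    by (metis proj_cases)
qed

section \<open>Weight spaces of \<open>L 0\<close>\<close>

definition weight_space :: "int \<Rightarrow> 'v set" where
  "weight_space k = {x. L 0 x = (lam + of_int k) *s x}"

lemma subspace_weight_space: "subspace (weight_space k)"
  by (rule subspaceI) (auto simp: weight_space_def L_zero L_add L_scale scale_right_distrib mult.commute)

lemma weight_space_act:
  assumes "x \<in> weight_space k"
  shows "act g x \<in> weight_space (k - mode g)"
proof -
  have "L 0 (act g x) = act g (L 0 x) - of_int (mode g) *s act g x"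
    by (cases g) (simp_all add: L_L[of 0 _ x] L_W[of 0 _ x])
  also have "act g (L 0 x) = (lam + of_int k) *s act g x"
    using assms by (simp add: weight_space_def act_scale)
  finally show ?thesis
    by (simp add: weight_space_def scale_left_distrib scale_left_diff_distrib)
qed

text \<open>Applying \<open>L 0 - k\<close> for finitely many \<open>k \<ge> a\<close> kills \<open>x\<close>, but multiplies a vector of weight
  below \<open>a\<close> by a nonzero scalar.\<close>

lemma weight_space_below:
  assumes x: "x \<in> span (\<Union>k\<in>{a..}. weight_space k)" and b: "x \<in> weight_space b" "b < a"
  shows "x = 0"
proof -
  define kill where "kill k y = L 0 y - (lam + of_int k) *s y" for k y
  have kill_add: "kill k (r *s y + z) = r *s kill k y + kill k z" for k r y z
    by (simp add: kill_def L_add L_scale algebra_simps)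
  have kills_add: "foldr kill ks (r *s y + z) = r *s foldr kill ks y + foldr kill ks z" for ks r y z
    by (induction ks) (simp_all add: kill_add)
  have kills_eigen: "foldr kill ks y = (\<Prod>k\<leftarrow>ks. of_int (l - k)) *s y" if "y \<in> weight_space l" for ks l y
    using that by (induction ks)
      (simp_all add: kill_def L_scale weight_space_def algebra_simps)
  have "\<exists>ks. set ks \<subseteq> {a..} \<and> foldr kill ks x = 0"
    using x
  proof (induction rule: span_induct_alt)
    case base
    show ?case
      by (rule exI[of _ "[]"]) simp
  next
    case (step r y z)
    then obtain ks k where "set ks \<subseteq> {a..}" "foldr kill ks z = 0" "k \<ge> a" "y \<in> weight_space k"
      by auto
    \<comment> \<open>The new factor goes in front: the old ones only rescale the eigenvector
      \<open>y\<close>, and \<open>kill k\<close> then annihilates the multiple.\<close>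
    moreover from this have "kill k (s *s y) = 0" for s
      by (simp add: kill_def L_scale weight_space_def mult.commute)
    ultimately show ?case
      by (intro exI[of _ "k # ks"]) (simp add: kills_add kills_eigen)
  qed
  then obtain ks where "set ks \<subseteq> {a..}" "(\<Prod>k\<leftarrow>ks. of_int (b - k)) *s x = 0"
    using kills_eigen[OF b(1)] by auto
  moreover from this have "(\<Prod>k\<leftarrow>ks. of_int (b - k) :: complex) \<noteq> 0"
    using b(2) by (auto simp: prod_list_zero_iff)
  ultimately show ?thesis
    by simp
qed

text \<open>The highest weight vector has relative weight 0 and lowering operators raise the weight,
  so vectors of weight at least 0 span the module.\<close>

lemma weight_space_neg:
  assumes "x \<in> weight_space k" "k < 0"
  shows "x = 0"
proof -
  have "x \<in> weight_space k \<and> k \<ge> 0" if "lowered d k x" for d k x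
    using that
  proof (induction rule: lowered.induct)
    case (one d)
    show ?case
      by (simp add: weight_space_def L0_one)
  next
    case (step d k x g)
    then show ?case
      using weight_space_act[of x k g] by simp
  qed
  then have "{x. \<exists>k. lowered d k x} \<subseteq> (\<Union>k\<in>{0..}. weight_space k)" for d
    by fastforce
  then have "x \<in> span (\<Union>k\<in>{0..}. weight_space k)"
    using lowered_span_exhausts[of x] span_mono unfolding lowered_span_def by blast
  then show ?thesis
    using assms by (rule weight_space_below)
qed

end

section \<open>Normal ordering by computation\<close>

text \<open>Association lists let the simplifier compute. \<open>add_term\<close> merges equal words
  and deletes zero coefficients, so that total cancellation shows as \<open>[]\<close>.\<close>

type_synonym lincomb = "(complex \<times> w3_gen list) list"

fun add_term :: "complex \<Rightarrow> w3_gen list \<Rightarrow> lincomb \<Rightarrow> lincomb" where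
  "add_term a m [] = (if a = 0 then [] else [(a, m)])"
| "add_term a m ((b, n) # xs) =
     (if m = n then if a + b = 0 then xs else (a + b, n) # xs else (b, n) # add_term a m xs)"

fun add_mult :: "complex \<Rightarrow> lincomb \<Rightarrow> lincomb \<Rightarrow> lincomb" where
  "add_mult k [] ys = ys"
| "add_mult k ((a, m) # xs) ys = add_term (k * a) m (add_mult k xs ys)"

fun extend :: "(w3_gen list \<Rightarrow> lincomb) \<Rightarrow> lincomb \<Rightarrow> lincomb" where
  "extend f [] = []"
| "extend f ((a, m) # xs) = add_mult a (f m) (extend f xs)"

fun weight :: "int \<Rightarrow> w3_gen list \<Rightarrow> int" where
  "weight h [] = h"
| "weight h (g # m) = weight h m - mode g"

text \<open>The thresholds match \<open>vacuum_base\<close>: \<open>L m\<close> with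
  \<open>m >= -1\<close> and \<open>W m\<close> with \<open>m >= -2\<close> kill the vacuum, so they
  are not left standing in front of a \<open>W\<close>.\<close>

fun in_order :: "w3_gen \<Rightarrow> w3_gen \<Rightarrow> bool" where
  "in_order (GenL m) (GenL n) \<longleftrightarrow> m \<le> n"
| "in_order (GenL m) (GenW n) \<longleftrightarrow> m \<le> -2"
| "in_order (GenW m) (GenL n) \<longleftrightarrow> False"
| "in_order (GenW m) (GenW n) \<longleftrightarrow> m \<le> n \<and> m \<le> -3"

fun sum_nf :: "('a \<Rightarrow> lincomb) \<Rightarrow> 'a list \<Rightarrow> lincomb" where
  "sum_nf f [] = []"
| "sum_nf f (j # js) = add_mult 1 (f j) (sum_nf f js)"

definition Lam_nf :: "(w3_gen \<Rightarrow> w3_gen list \<Rightarrow> lincomb) \<Rightarrow> int \<Rightarrow> int \<Rightarrow> w3_gen list \<Rightarrow> lincomb" where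
  "Lam_nf f N m t =
     add_mult 1 (sum_nf (\<lambda>j. extend (f (GenL (- j))) (f (GenL (m + j)) t)) [2..N - m])
     (add_mult 1 (sum_nf (\<lambda>j. extend (f (GenL (m - j))) (f (GenL j) t)) [-1..N])
     (add_mult (- (3 / 10 * (of_int m + 2) * (of_int m + 3))) (f (GenL m) t) []))"

text \<open>The recursive call enters as \<open>f\<close>, so that \<open>nf\<close> can be
  primitive recursive in its bound. The cut-off \<open>weight h t\<close> for \<open>Lam_nf\<close>
  is right because \<open>L j\<close> with larger \<open>j\<close> sends the word \<open>t\<close>
  to negative weight.\<close>

fun bracket_nf :: "int \<Rightarrow> (w3_gen \<Rightarrow> w3_gen list \<Rightarrow> lincomb) \<Rightarrow> w3_gen \<Rightarrow> w3_gen \<Rightarrow> w3_gen list \<Rightarrow> lincomb" where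
  "bracket_nf h f (GenL m) (GenL n) t =
     add_mult (of_int (m - n)) (f (GenL (m + n)) t)
       (if m + n = 0 then [((of_int m ^ 3 - of_int m) / 12, t)] else [])"
| "bracket_nf h f (GenL m) (GenW n) t = add_mult (of_int (2 * m - n)) (f (GenW (m + n)) t) []"
| "bracket_nf h f (GenW m) (GenL n) t = add_mult (of_int (m - 2 * n)) (f (GenW (m + n)) t) []"
| "bracket_nf h f (GenW m) (GenW n) t =
     add_mult (of_int (m - n) *
             (1 / 15 * (of_int m + of_int n + 2) * (of_int m + of_int n + 3)
              - 1 / 6 * (of_int m + 2) * (of_int n + 2))) (f (GenL (m + n)) t)
     (add_mult (16 / 27 * of_int (m - n)) (Lam_nf f (weight h t) (m + n) t)
     (if m + n = 0 then [(of_int m * (of_int m ^ 2 - 1) * (of_int m ^ 2 - 4) / 360, t)] else []))"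

text \<open>\<open>nf h b k g m\<close> rewrites \<open>g\<close> applied to the word \<open>m\<close> on a vector of \<open>L 0\<close>-weight \<open>h\<close>, on which
  the generators act by \<open>b\<close>. The number \<open>k\<close> only bounds the recursion depth: the result is
  correct, if perhaps not in normal form, for every \<open>k\<close>. Words of negative weight vanish.
  The structure constants are those for \<open>c = 1\<close>, where \<open>16 / (22 + 5 c) = 16 / 27\<close>.\<close>

primrec nf :: "int \<Rightarrow> (w3_gen \<Rightarrow> lincomb) \<Rightarrow> nat \<Rightarrow> w3_gen \<Rightarrow> w3_gen list \<Rightarrow> lincomb" where
  "nf h b 0 = (\<lambda>g m. [(1, g # m)])"
| "nf h b (Suc k) = (\<lambda>g m.
     if mode g > weight h m then []
     else case m of [] \<Rightarrow> b g
       | x # t \<Rightarrow> if in_order g x then [(1, g # m)]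
           else add_mult 1 (extend (nf h b k x) (nf h b k g t)) (bracket_nf h (nf h b k) g x t))"

fun vacuum_base :: "w3_gen \<Rightarrow> lincomb" where
  "vacuum_base (GenL m) = (if m \<ge> -1 then [] else [(1, [GenL m])])"
| "vacuum_base (GenW m) = (if m \<ge> -2 then [] else [(1, [GenW m])])"

text \<open>The action on a primary vector of weight 9 killed by all \<open>W m\<close> with
  \<open>m > N\<close>. By weights \<open>N = 9\<close> is always allowed; the vector built from
  \<open>weight9\<close> allows \<open>N = 3\<close>.\<close>

fun primary_base :: "int \<Rightarrow> w3_gen \<Rightarrow> lincomb" where
  "primary_base N (GenL m) = (if m > 0 then [] else if m = 0 then [(9, [])] else [(1, [GenL m])])"
| "primary_base N (GenW m) = (if m > N then [] else [(1, [GenW m])])"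

text \<open>The unique primary vector with leading term \<open>W\<^sub>-\<^sub>3W\<^sub>-\<^sub>3W\<^sub>-\<^sub>3\<one>\<close>, up to clearing denominators.
  Its other coefficients solve the linear system \<open>L\<^sub>1 v = L\<^sub>2 v = 0\<close>.\<close>

definition weight9 :: lincomb where
  "weight9 = [(1104246, [GenW (-3), GenW (-3), GenW (-3)]),
    (-71592, [GenL (-6), GenW (-3)]),
    (-1459820, [GenL (-5), GenW (-4)]),
    (-3434688, [GenL (-4), GenL (-2), GenW (-3)]),
    (1788472, [GenL (-4), GenW (-5)]),
    (-2498025, [GenL (-3), GenL (-3), GenW (-3)]),
    (2709084, [GenL (-3), GenL (-2), GenW (-4)]),
    (-4136862, [GenL (-3), GenW (-6)]),
    (141344, [GenL (-2), GenL (-2), GenL (-2), GenW (-3)]),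
    (-1729776, [GenL (-2), GenL (-2), GenW (-5)]),
    (935704, [GenL (-2), GenW (-7)]),
    (6383120, [GenW (-9)])]"

text \<open>This is \<open>f\<^sub>7\<close> in the Benoit--Saint-Aubin recursion \<open>f\<^sub>0 = v\<close>,
  \<open>f\<^sub>r = \<Sum>k=1..r. (-1)\<^bsup>k-1\<^esup> (\<Prod>i=r-k+1..r-1. i (7 - i)) L\<^sub>-\<^sub>k f\<^bsub>r-k\<^esub>\<close>.\<close>

definition singular :: lincomb where
  "singular = [(1, [GenL (-1), GenL (-1), GenL (-1), GenL (-1), GenL (-1), GenL (-1), GenL (-1)]),
    (-56, [GenL (-2), GenL (-1), GenL (-1), GenL (-1), GenL (-1), GenL (-1)]),
    (364, [GenL (-3), GenL (-1), GenL (-1), GenL (-1), GenL (-1)]),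
    (-2640, [GenL (-4), GenL (-1), GenL (-1), GenL (-1)]),
    (13760, [GenL (-5), GenL (-1), GenL (-1)]),
    (-58400, [GenL (-6), GenL (-1)]),
    (131400, [GenL (-7)]),
    (784, [GenL (-2), GenL (-2), GenL (-1), GenL (-1), GenL (-1)]),
    (-6576, [GenL (-3), GenL (-2), GenL (-1), GenL (-1)]),
    (10252, [GenL (-3), GenL (-3), GenL (-1)]),
    (25280, [GenL (-4), GenL (-2), GenL (-1)]),
    (-43128, [GenL (-4), GenL (-3)]),
    (-47088, [GenL (-5), GenL (-2)]),
    (-2304, [GenL (-2), GenL (-2), GenL (-2), GenL (-1)]),
    (10368, [GenL (-3), GenL (-2), GenL (-2)])]"

text \<open>Keeps the simplifier from unfolding summands before the summation index is a numeral.\<close>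

lemma sum_nf_cong [cong]: "js = js' \<Longrightarrow> sum_nf f js = sum_nf f js'"
  by simp

lemma upto_unfold:
  "[-1..n] = (if -1 \<le> n then -1 # [0..n] else [])"
  "[0..n] = (if 0 \<le> n then 0 # [1..n] else [])"
  "[1..n] = (if 1 \<le> n then 1 # [2..n] else [])"
  by (simp_all add: upto_rec1)

text \<open>Unfolds one level with the bound kept a numeral, and only on words already in
  constructor form.\<close>

lemma nf_numeral:
  "nf h b (numeral k) g [] = (if mode g > h then [] else b g)"
  "nf h b (numeral k) g (x # t) =
     (if mode g > weight h (x # t) then []
      else if in_order g x then [(1, g # x # t)]
      else add_mult 1 (extend (nf h b (pred_numeral k) x) (nf h b (pred_numeral k) g t))
             (bracket_nf h (nf h b (pred_numeral k)) g x t))"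
  by (simp_all add: numeral_eq_Suc)

lemmas nf_eval = upto_unfold weight9_def singular_def Lam_nf_def nf_numeral

lemma weight9_eval:
  "extend (nf 0 vacuum_base 20 (GenL 1)) weight9 = []"
  "extend (nf 0 vacuum_base 20 (GenL 2)) weight9 = []"
  "extend (nf 0 vacuum_base 20 (GenW 4)) weight9 = []"
  "extend (nf 0 vacuum_base 20 (GenW 3)) (extend (nf 0 vacuum_base 20 (GenW 3)) weight9)
     = [(1235051840 / 9, [GenW (-3)])]"
  by (simp_all add: nf_eval del: nf.simps)

text \<open>In the last equation each commutator of a \<open>W\<close> with an \<open>L\<close> is a
  single \<open>W\<close>, so the words are products of lowering \<open>L\<close>'s applied to some
  \<open>W k\<close>, of total mode 3. This forces \<open>k >= 3\<close>, and \<open>N = 3\<close>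
  leaves only \<open>W 3\<close>.\<close>

lemma singular_eval:
  "extend (nf 9 (primary_base 9) 20 (GenL 1)) singular = []"
  "extend (nf 9 (primary_base 9) 20 (GenL 2)) singular = []"
  "extend (nf 9 (primary_base 3) 20 (GenW 10)) singular = [(81216, [GenW 3])]"
  by (simp_all add: nf_eval del: nf.simps)

text \<open>The coefficient is the central term \<open>c / 3\<close> at \<open>c = 1\<close>; it
  shows that \<open>W (-3) one\<close> is nonzero.\<close>

lemma w_eval: "nf 0 vacuum_base 20 (GenW 3) [GenW (-3)] = [(1 / 3, [])]"
  by (simp add: nf_eval del: nf.simps)

section \<open>Soundness of the rewriting\<close>

locale w3_c1_voa =
  w3_irreducible_quotient scale 1 0 0 L W one + vertex_operator_algebra scale Y one omega 1
  for scale :: "complex \<Rightarrow> 'v::ab_group_add \<Rightarrow> 'v" (infixr \<open>*s\<close> 75)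
    and L W :: "int \<Rightarrow> 'v \<Rightarrow> 'v"
    and one :: 'v
    and Y :: "'v \<Rightarrow> int \<Rightarrow> 'v \<Rightarrow> 'v"
    and omega :: 'v +
  assumes Y_omega: "Y omega n = L (n - 1)"
    and Y_w: "Y (W (-3) one) n = W (n - 2)"
begin

definition word :: "'v \<Rightarrow> w3_gen list \<Rightarrow> 'v" where
  "word b m = foldr act m b"

definition sem :: "'v \<Rightarrow> lincomb \<Rightarrow> 'v" where
  "sem b xs = (\<Sum>(a, m)\<leftarrow>xs. a *s word b m)"

lemma word_simps [simp]: "word b [] = b" "word b (g # m) = act g (word b m)"
  by (simp_all add: word_def)

lemma sem_simps [simp]: "sem b [] = 0" "sem b ((a, m) # xs) = a *s word b m + sem b xs"
  by (simp_all add: sem_def)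

lemma sem_add_term: "sem b (add_term a m xs) = a *s word b m + sem b xs"
proof (induction a m xs rule: add_term.induct)
  case (2 a m b' n xs)
  have "a *s x + b' *s x = 0" if "a + b' = 0" for x
    using that scale_left_distrib[of a b' x] by simp
  then show ?case
    using 2 by (auto simp: scale_left_distrib add.assoc add.left_commute)
qed auto

lemma sem_add_mult: "sem b (add_mult k xs ys) = k *s sem b xs + sem b ys"
  by (induction k xs ys rule: add_mult.induct) (auto simp: sem_add_term scale_right_distrib add.assoc)

lemma sem_extend:
  "(\<And>m. sem b (f m) = act g (word b m)) \<Longrightarrow> sem b (extend f xs) = act g (sem b xs)"
  by (induction xs) (auto simp: sem_add_mult act_zero act_add act_scale)

lemma sem_sum_nf: "sem b (sum_nf f js) = (\<Sum>j\<leftarrow>js. sem b (f j))"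
  by (induction js) (auto simp: sem_add_mult)

lemma sum_upto_eq: "(\<Sum>j\<leftarrow>[m..n]. f j) = (\<Sum>j\<in>{m..n}. f j)" for f :: "int \<Rightarrow> 'v"
  by (simp add: sum_list_distinct_conv_sum_set)

lemma word_weight: "b \<in> weight_space h \<Longrightarrow> word b m \<in> weight_space (weight h m)"
  by (induction m) (auto intro: weight_space_act)

lemma word_act_zero:
  "b \<in> weight_space h \<Longrightarrow> mode g > weight h m \<Longrightarrow> act g (word b m) = 0"
  using weight_space_neg[OF weight_space_act[OF word_weight[of b h m], of g]] by simp

lemma sem_Lam_nf:
  assumes "\<And>g m. sem b (f g m) = act g (word b m)"
  shows "sem b (Lam_nf f N m t) = Lam N m (word b t)"
  by (simp add: Lam_nf_def Lam_def sem_add_mult sem_sum_nf sum_upto_eq sem_extend[OF assms] assms)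

lemma sem_bracket_nf:
  assumes f: "\<And>g m. sem b (f g m) = act g (word b m)" and b: "b \<in> weight_space h"
  shows "act g (act x (word b t)) = act x (act g (word b t)) + sem b (bracket_nf h f g x t)"
proof (cases g)
  case g: (GenL m)
  show ?thesis
    using L_L[of m _ "word b t"] L_W[of m _ "word b t"] by (cases x) (auto simp: sem_add_mult f g)
next
  case g: (GenW m)
  \<comment> \<open>Makes the cut-off of \<open>Lam_nf\<close> admissible in
    \<open>W_W\<close>.\<close>
  have "L j (word b t) = 0" if "j > weight h t" for j
    using word_act_zero[OF b, of t "GenL j"] that by simp
  then show ?thesis
    using W_L[of m _ "word b t"] W_W[of "weight h t" "word b t" m]
    by (cases x) (auto simp: sem_add_mult f g sem_Lam_nf[OF f] add.assoc)
qed

lemma sem_nf: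
  assumes b: "b \<in> weight_space h" and base: "\<And>g. sem b (base g) = act g b"
  shows "sem b (nf h base k g m) = act g (word b m)"
proof (induction k arbitrary: g m)
  case 0
  show ?case
    by simp
next
  case (Suc k)
  show ?case
  proof (cases m)
    case Nil
    then show ?thesis
      using word_act_zero[OF b, of "[]" g] base[of g] by simp
  next
    case (Cons x t)
    then show ?thesis
      using word_act_zero[OF b, of m g] sem_bracket_nf[of b "nf h base k" h g x t, OF Suc b]
      by (simp add: sem_add_mult sem_extend[OF Suc] Suc)
  qed
qed

lemma sem_extend_nf:
  assumes "b \<in> weight_space h" and "\<And>g. sem b (base g) = act g b"
  shows "sem b (extend (nf h base k g) xs) = act g (sem b xs)"
  using assms by (intro sem_extend sem_nf)

lemma one_weight: "one \<in> weight_space 0"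
  using L0_one by (simp add: weight_space_def)

text \<open>By the creation property the modes \<open>omega_0\<close>, \<open>w_0\<close> and
  \<open>w_1\<close> kill the vacuum; these are \<open>L (-1)\<close>, \<open>W (-2)\<close> and
  \<open>W (-1)\<close>.\<close>

lemma sem_vacuum_base: "sem one (vacuum_base g) = act g one"
proof (cases g)
  case (GenL m)
  then show ?thesis
    using creation(1)[of "m + 1" omega] by (simp add: Y_omega)
next
  case (GenW m)
  then show ?thesis
    using creation(1)[of "m + 2" "W (-3) one"] by (simp add: Y_w)
qed

lemma one_neq_0: "one \<noteq> 0"
proof
  assume "one = 0"
  then have "v = 0" for v :: 'v
    using creation(2)[of v] Y_scale_right[of v "-1" 0 0] by simp
  then show False
    using nontrivial by blast
qed

lemma w_neq_0: "W (-3) one \<noteq> 0"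
  using sem_nf[OF one_weight sem_vacuum_base, of 20 "GenW 3" "[GenW (-3)]"] one_neq_0
  by (auto simp: w_eval W_zero)

section \<open>Primary vectors of weight 9 and the singular vector\<close>

lemma L_pos_zero:
  assumes "L 1 x = 0" "L 2 x = 0" "n > 0"
  shows "L n x = 0"
proof -
  have "L (int k + 2) x = 0" for k
  proof (induction k)
    case (Suc k)
    then show ?case
      \<comment> \<open>The bracket of \<open>L (k + 2)\<close> and \<open>L 1\<close> is
        \<open>(k + 1) L (k + 3)\<close>, with nonzero coefficient.\<close>
      using L_L[of "int k + 2" 1 x] assms of_nat_neq_0[of k, where 'a = complex]
      by (auto simp: L_zero add.commute)
  qed (use assms in simp)
  from this[of "nat (n - 2)"] show ?thesis
    using assms by (cases "n = 1") auto
qed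

text \<open>The bracket of \<open>L 1\<close> and \<open>W n\<close> is
  \<open>(2 - n) W (n + 1)\<close>, and \<open>2 - n\<close> is nonzero from \<open>n = 4\<close>
  on.\<close>

lemma W_ge_zero:
  assumes "L 1 x = 0" "W 4 x = 0" "n \<ge> 4"
  shows "W n x = 0"
proof -
  have "W (int k + 4) x = 0" for k
  proof (induction k)
    case (Suc k)
    have "of_int (2 - (int k + 4)) \<noteq> (0 :: complex)"
      by (simp only: of_int_eq_0_iff)
    then show ?case
      using L_W[of 1 "int k + 4" x] Suc assms by (simp add: L_zero W_zero add.commute)
  qed (use assms in simp)
  from this[of "nat (n - 4)"] show ?thesis
    using assms by auto
qed

lemma sem_weight:
  "b \<in> weight_space h \<Longrightarrow> \<forall>(a, m)\<in>set xs. weight h m = k \<Longrightarrow> sem b xs \<in> weight_space k"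
  by (induction xs)
    (auto intro!: subspace_add[OF subspace_weight_space] subspace_scale[OF subspace_weight_space]
       subspace_0[OF subspace_weight_space] intro: word_weight)

definition primary9 :: "'v \<Rightarrow> bool" where
  "primary9 b \<longleftrightarrow> b \<in> weight_space 9 \<and> (\<forall>n>0. L n b = 0)"

lemma sem_primary_base:
  assumes "primary9 b" and "\<forall>n>N. W n b = 0"
  shows "sem b (primary_base N g) = act g b"
  using assms by (cases g) (auto simp: primary9_def weight_space_def not_less)

lemma sem_singular:
  assumes "primary9 b"
  shows "sem b singular \<in> weight_space 16" "L 1 (sem b singular) = 0" "L 2 (sem b singular) = 0"
proof -
  have b: "b \<in> weight_space 9"
    using assms by (simp add: primary9_def)
  have "\<forall>n>9. W n b = 0"
    using weight_space_neg[OF weight_space_act[OF b, of "GenW n" for n]] by simp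
  note nf = sem_extend_nf[OF b sem_primary_base[OF assms this], of 20 _ singular]
  show "L 1 (sem b singular) = 0" "L 2 (sem b singular) = 0"
    using nf[of "GenL 1"] nf[of "GenL 2"] by (simp_all add: singular_eval)
  show "sem b singular \<in> weight_space 16"
    by (rule sem_weight[OF b]) (simp add: singular_def)
qed

lemma exists_primary9: "\<exists>v. primary9 v \<and> sem v singular \<noteq> 0"
proof
  define v where "v = sem one weight9"
  note nf = sem_extend_nf[OF one_weight sem_vacuum_base, of 20]
  have L: "L 1 v = 0" "L 2 v = 0" and W: "W 4 v = 0"
    using nf[of "GenL 1" weight9] nf[of "GenL 2" weight9] nf[of "GenW 4" weight9]
    by (simp_all add: weight9_eval v_def)
  have v9: "v \<in> weight_space 9"
    unfolding v_def by (rule sem_weight[OF one_weight]) (simp add: weight9_def)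
  then have v: "primary9 v"
    using L_pos_zero[OF L] by (simp add: primary9_def)
  \<comment> \<open>A second \<open>W 3\<close> leads to a multiple of \<open>W (-3) one\<close>, so
    that \<open>w_neq_0\<close> replaces a linear independence argument in weight 6.\<close>
  have "W 3 (W 3 v) = (1235051840 / 9) *s W (-3) one"
    using nf[of "GenW 3" "extend (nf 0 vacuum_base 20 (GenW 3)) weight9"] nf[of "GenW 3" weight9]
    by (simp add: weight9_eval v_def)
  then have "W 3 v \<noteq> 0"
    using w_neq_0 by (auto simp: W_zero)
  moreover have W3: "\<forall>n>3. W n v = 0"
    using W_ge_zero[OF L(1) W] by simp
  have "W 10 (sem v singular) = 81216 *s W 3 v"
    using sem_extend_nf[OF v9 sem_primary_base[OF v W3], of 20 "GenW 10" singular]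
    by (simp add: singular_eval)
  ultimately have "sem v singular \<noteq> 0"
    by (auto simp: W_zero)
  with v show "primary9 v \<and> sem v singular \<noteq> 0" ..
qed

end

section \<open>Submodules over the Virasoro subalgebra\<close>

context vertex_algebra
begin

text \<open>The Borcherds identity at \<open>m = 0\<close>, where only \<open>i = 0\<close> survives
  on the left.\<close>

lemma Y_iterate:
  "Y (Y a n b) k v = Sum_any (\<lambda>i::nat. ((-1) ^ i * (of_int n gchoose i)) *s
     (Y a (n - int i) (Y b (k + int i) v) - ((-1) powi n) *s Y b (n + k - int i) (Y a (int i) v)))"
proof -
  have "Sum_any (\<lambda>i::nat. (of_int 0 gchoose i) *s Y (Y a (n + int i) b) (k - int i) v)
      = (\<Sum>i\<in>{0}. (of_int 0 gchoose i) *s Y (Y a (n + int i) b) (k - int i) v)"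
    by (rule Sum_any.expand_superset) (auto simp: gbinomial_0_left)
  then show ?thesis
    using borcherds[of 0 a n b k v] by simp
qed

text \<open>Infinite support does no harm: \<open>Sum_any\<close> is then 0 by convention.\<close>

lemma Sum_any_in_subspace: "subspace K \<Longrightarrow> (\<And>i. f i \<in> K) \<Longrightarrow> Sum_any f \<in> K"
  unfolding Sum_any.expand_set by (rule subspace_sum)

text \<open>By \<open>Y_iterate\<close> the modes of \<open>Y a n b\<close> are built from those of
  \<open>a\<close> and \<open>b\<close>, so stability passes from the generators to the whole
  subalgebra.\<close>

lemma submodule_generated:
  assumes K: "subspace K" and S: "\<And>a n v. a \<in> S \<Longrightarrow> v \<in> K \<Longrightarrow> Y a n v \<in> K"
  shows "submodule (generated_subalgebra S) K"
proof -
  have "\<forall>n. \<forall>v\<in>K. Y a n v \<in> K" if "a \<in> generated_subalgebra S" for a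
    using that
  proof (induction rule: generated_subalgebra.induct)
    case (base a)
    then show ?case
      using S by blast
  next
    case zero
    have "Y 0 n v = 0" for n v
      using Y_scale_left[of 0 0 n v] by simp
    then show ?case
      using subspace_0[OF K] by simp
  next
    case vac
    show ?case
      using subspace_0[OF K] by (simp add: vacuum)
  next
    case (add a b)
    then show ?case
      using K by (simp add: Y_add_left subspace_add)
  next
    case (scale a r)
    then show ?case
      using K by (simp add: Y_scale_left subspace_scale)
  next
    case (mode a b n)
    then show ?case
      unfolding Y_iterate
      by (auto intro!: Sum_any_in_subspace K subspace_scale[OF K] subspace_diff[OF K])
  qed
  then show ?thesis
    using K by (simp add: submodule_def)
qed

text \<open>The component \<open>f N\<close> is minus the sum of the others, hence lies in the span
  of the other summands.\<close>

lemma direct_sum_zero: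
  assumes indep: "\<And>N. N \<in> F \<Longrightarrow> N \<inter> span (\<Union>(F - {N})) = {0}"
    and F': "finite F'" "F' \<subseteq> F" and f: "\<And>N. N \<in> F' \<Longrightarrow> f N \<in> N" and sum: "sum f F' = 0"
    and N: "N \<in> F'" "subspace N"
  shows "f N = 0"
proof -
  have "f N = - sum f (F' - {N})"
    using sum F'(1) N(1) by (simp add: sum.remove eq_neg_iff_add_eq_0)
  also have "\<dots> \<in> span (\<Union>(F - {N}))"
    using f F'(2) by (intro span_neg span_sum span_base) blast
  finally show ?thesis
    using indep[of N] f[OF N(1)] F'(2) N(1) by blast
qed

lemma span_Union_decomposition:
  assumes "x \<in> span (\<Union>F)" and F: "\<And>N. N \<in> F \<Longrightarrow> subspace N"
  shows "\<exists>F' f. finite F' \<and> F' \<subseteq> F \<and> (\<forall>N\<in>F'. f N \<in> N) \<and> x = sum f F'"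
  using assms(1)
proof (induction rule: span_induct_alt)
  case base
  show ?case
    by (rule exI[of _ "{}"]) simp
next
  case (step r a y)
  then obtain N F' f where N: "N \<in> F" "a \<in> N" and F': "finite F'" "F' \<subseteq> F" "\<forall>M\<in>F'. f M \<in> M" "y = sum f F'"
    by auto
  \<comment> \<open>The summand \<open>N\<close> may already occur in \<open>F'\<close>; its old
    component is then kept and increased.\<close>
  define g where "g = f(N := r *s a + (if N \<in> F' then f N else 0))"
  have "sum g (insert N F') = g N + sum f (F' - {N})"
    using F'(1) by (simp add: sum.insert_remove g_def)
  also have "\<dots> = r *s a + y"
    using F'(1,4) by (auto simp: g_def sum.remove[of F' N f] add.assoc)
  finally have "r *s a + y = sum g (insert N F')" ..
  moreover have "\<forall>M\<in>insert N F'. g M \<in> M"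
    using F'(3) N F[OF N(1)] by (auto simp: g_def subspace_add subspace_scale subspace_0)
  ultimately show ?case
    using F'(1,2) N(1) by (intro exI[of _ "insert N F'"] exI[of _ g]) simp
qed

end

section \<open>Virasoro descendants and the contradiction\<close>

context w3_c1_voa
begin

abbreviation "vir \<equiv> generated_subalgebra {omega}"

lemma submodule_L:
  assumes "submodule vir K" "x \<in> K"
  shows "L n x \<in> K"
proof -
  have "Y omega (n + 1) x \<in> K"
    using assms generated_subalgebra.base[of omega "{omega}"] unfolding submodule_def by blast
  then show ?thesis
    by (simp add: Y_omega)
qed

text \<open>\<open>L (-1)\<close> and \<open>L (-2)\<close> generate all negative modes, so this
  will be the Virasoro submodule of a singular vector, with only two operators to commute
  past.\<close>

inductive_set descendants :: "'v \<Rightarrow> 'v set" for s where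
  base: "s \<in> descendants s"
| zero: "0 \<in> descendants s"
| add: "x \<in> descendants s \<Longrightarrow> y \<in> descendants s \<Longrightarrow> x + y \<in> descendants s"
| scale: "x \<in> descendants s \<Longrightarrow> r *s x \<in> descendants s"
| L_m1: "x \<in> descendants s \<Longrightarrow> L (-1) x \<in> descendants s"
| L_m2: "x \<in> descendants s \<Longrightarrow> L (-2) x \<in> descendants s"

lemma subspace_descendants: "subspace (descendants s)"
  by (rule subspaceI) (auto intro: descendants.intros)

lemma descendants_subset:
  assumes "subspace K" "\<And>n x. n < 0 \<Longrightarrow> x \<in> K \<Longrightarrow> L n x \<in> K" "s \<in> K"
  shows "descendants s \<subseteq> K"
proof
  fix x assume "x \<in> descendants s"
  then show "x \<in> K"
    by (induction rule: descendants.induct)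
      (use assms in \<open>auto intro: subspace_0 subspace_add subspace_scale\<close>)
qed

text \<open>Commuting \<open>L 0\<close>, \<open>L 1\<close>, \<open>L 2\<close> past
  \<open>L (-1)\<close>, \<open>L (-2)\<close> yields only modes between -2 and 1 and scalars, so
  induction settles these three. Brackets with \<open>L 1\<close> and \<open>L (-1)\<close> then
  reach the remaining modes.\<close>

lemma descendants_L:
  assumes s: "s \<in> weight_space h" "L 1 s = 0" "L 2 s = 0" and x: "x \<in> descendants s"
  shows "L n x \<in> descendants s"
proof -
  note [intro] = descendants.intros
  have nonneg: "L 0 x \<in> descendants s \<and> L 1 x \<in> descendants s \<and> L 2 x \<in> descendants s"
    if "x \<in> descendants s" for x
    using that
  proof (induction rule: descendants.induct)
    case base
    then show ?case
      using s by (auto simp: weight_space_def)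
  next
    case (L_m1 x)
    then show ?case
      by (auto simp: L_L[of 0 "-1"] L_L[of 1 "-1"] L_L[of 2 "-1"])
  next
    case (L_m2 x)
    then show ?case
      by (auto simp: L_L[of 0 "-2"] L_L[of 1 "-2"] L_L[of 2 "-2"])
  qed (auto simp: L_zero L_add L_scale)
  have up: "\<forall>x\<in>descendants s. L (int k + 2) x \<in> descendants s" for k
  proof (induction k)
    case (Suc k)
    have "L (int (Suc k) + 2) x \<in> descendants s" if x: "x \<in> descendants s" for x
    proof -
      have "L (int k + 2) (L 1 x) - L 1 (L (int k + 2) x) \<in> descendants s"
        using Suc nonneg x by (intro subspace_diff[OF subspace_descendants]) auto
      then have "of_nat (Suc k) *s L (int k + 3) x \<in> descendants s"
        by (simp add: L_L[of "int k + 2" 1 x] add.commute)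
      then have "L (int k + 3) x \<in> descendants s"
        using descendants.scale[of "of_nat (Suc k) *s L (int k + 3) x" s "1 / of_nat (Suc k)"]
        by (simp del: of_nat_Suc)
      then show ?thesis
        by (simp add: algebra_simps)
    qed
    then show ?case
      by blast
  qed (use nonneg in auto)
  have down: "\<forall>x\<in>descendants s. L (- int k - 2) x \<in> descendants s" for k
  proof (induction k)
    case (Suc k)
    have "L (- int (Suc k) - 2) x \<in> descendants s" if x: "x \<in> descendants s" for x
    proof -
      have "L (-1) (L (- int k - 2) x) - L (- int k - 2) (L (-1) x) \<in> descendants s"
        using Suc x by (intro subspace_diff[OF subspace_descendants]) auto
      then have "of_nat (Suc k) *s L (- int k - 3) x \<in> descendants s"
        by (simp add: L_L[of "-1" "- int k - 2" x] add.commute)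
      then have "L (- int k - 3) x \<in> descendants s"
        using descendants.scale[of "of_nat (Suc k) *s L (- int k - 3) x" s "1 / of_nat (Suc k)"]
        by (simp del: of_nat_Suc)
      then show ?thesis
        by (simp add: algebra_simps)
    qed
    then show ?case
      by blast
  qed auto
  consider "n \<ge> 2" | "n \<in> {0, 1}" | "n = -1" | "n \<le> -2"
    by force
  then show ?thesis
    using up[of "nat (n - 2)"] down[of "nat (- n - 2)"] nonneg x by cases auto
qed

lemma singular_zero_in_irreducible:
  assumes N: "irreducible_submodule vir N" and x: "x \<in> N" "primary9 x"
  shows "sem x singular = 0"
proof (rule ccontr)
  define s where "s = sem x singular"
  assume "sem x singular \<noteq> 0"
  then have "s \<noteq> 0"
    by (simp add: s_def)
  note s = sem_singular[OF x(2), folded s_def]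
  have sub: "submodule vir N"
    using N by (simp add: irreducible_submodule_def)
  then have subN: "subspace N"
    by (simp add: submodule_def)
  have "s \<in> N"
    using submodule_L[OF sub] x(1) subspace_add[OF subN] subspace_scale[OF subN] subspace_diff[OF subN]
    by (simp add: s_def singular_def)
  then have "descendants s \<subseteq> N"
    using submodule_L[OF sub] subN by (intro descendants_subset)
  moreover have "submodule vir (descendants s)"
    using descendants_L[OF s] by (intro submodule_generated subspace_descendants) (auto simp: Y_omega)
  ultimately have "descendants s = N"
    using N descendants.base[of s] \<open>s \<noteq> 0\<close> by (auto simp: irreducible_submodule_def)
  \<comment> \<open>Negative modes raise the weight, so all of \<open>N\<close> would sit in weights
    at least 16, while \<open>x\<close> in \<open>N\<close> has weight 9.\<close>
  moreover have "descendants s \<subseteq> span (\<Union>k\<in>{16..}. weight_space k)"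
  proof (rule descendants_subset)
    fix n :: int and y assume "n < 0" "y \<in> span (\<Union>k\<in>{16..}. weight_space k)"
    then have "act (GenL n) y \<in> span (\<Union>k\<in>{16..}. weight_space k)"
    proof (elim act_span)
      fix b assume "b \<in> (\<Union>k\<in>{16..}. weight_space k)"
      then obtain k where "k \<ge> 16" "b \<in> weight_space k"
        by auto
      then have "act (GenL n) b \<in> weight_space (k - n)" "k - n \<ge> 16"
        using weight_space_act[of b k "GenL n"] \<open>n < 0\<close> by simp_all
      then show "act (GenL n) b \<in> span (\<Union>k\<in>{16..}. weight_space k)"
        by (intro span_base) blast
    qed
    then show "L n y \<in> span (\<Union>k\<in>{16..}. weight_space k)"
      by simp
  qed (use s in \<open>auto intro: span_base\<close>)
  ultimately have "x = 0"
    using x weight_space_below[of x 16 9] by (auto simp: primary9_def)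
  then show False
    using \<open>sem x singular \<noteq> 0\<close> s(1) act_zero by (simp add: singular_def L_zero)
qed

lemma sem_sum: "sem (sum f A) xs = (\<Sum>i\<in>A. sem (f i) xs)"
proof -
  have word: "word (sum f A) m = (\<Sum>i\<in>A. word (f i) m)" for m
    by (induction m) (simp_all add: act_sum)
  show ?thesis
    by (induction xs) (auto simp: word scale_sum_right sum.distrib)
qed

lemma not_completely_reducible: "\<not> completely_reducible vir"
proof
  assume "completely_reducible vir"
  then obtain F where irr: "\<And>N. N \<in> F \<Longrightarrow> irreducible_submodule vir N"
    and span: "span (\<Union>F) = UNIV" and indep: "\<And>N. N \<in> F \<Longrightarrow> N \<inter> span (\<Union>(F - {N})) = {0}"
    unfolding completely_reducible_def by blast
  have sub: "submodule vir N" and subN: "subspace N" if "N \<in> F" for N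
    using irr[OF that] by (auto simp: irreducible_submodule_def submodule_def)
  obtain v where v: "primary9 v" "sem v singular \<noteq> 0"
    using exists_primary9 by blast
  obtain F' f where F': "finite F'" "F' \<subseteq> F" and f: "\<And>N. N \<in> F' \<Longrightarrow> f N \<in> N" and vf: "v = sum f F'"
    using span_Union_decomposition[of v F] span subN by blast
  have "primary9 (f N)" if N: "N \<in> F'" for N
  proof -
    have "L n (f N) = 0" if "n > 0" for n
    proof -
      \<comment> \<open>Each \<open>L n (f N)\<close> lies in \<open>N\<close>, so by directness the
        vanishing sum vanishes termwise; the same is then done with \<open>L 0 - 9\<close>.\<close>
      have "(\<Sum>N\<in>F'. L n (f N)) = 0"
        using v(1) that by (simp add: primary9_def vf L_sum)
      then show ?thesis
        using direct_sum_zero[of F F' "\<lambda>N. L n (f N)" N] indep F' N subN submodule_L sub f by blast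
    qed
    moreover have "L 0 (f N) - 9 *s f N = 0"
    proof -
      have "(\<Sum>N\<in>F'. L 0 (f N) - 9 *s f N) = 0"
        using v(1) by (simp add: primary9_def weight_space_def vf L_sum sum_subtractf scale_sum_right)
      moreover have "L 0 (f M) - 9 *s f M \<in> M" if "M \<in> F'" for M
        using that F'(2) by (intro subspace_diff subspace_scale submodule_L sub subN f) auto
      ultimately show ?thesis
        using direct_sum_zero[of F F' "\<lambda>N. L 0 (f N) - 9 *s f N" N] indep F' N subN by blast
    qed
    ultimately show ?thesis
      by (simp add: primary9_def weight_space_def)
  qed
  then have "sem (f N) singular = 0" if "N \<in> F'" for N
    using singular_zero_in_irreducible irr f F'(2) that by blast
  then show False
    using v(2) by (simp add: vf sem_sum)
qed

end

theorem theorem3p2: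
  fixes scale :: "complex \<Rightarrow> 'v::ab_group_add \<Rightarrow> 'v"
    and L W :: "int \<Rightarrow> 'v \<Rightarrow> 'v"
    and one omega w :: 'v
    and Y :: "'v \<Rightarrow> int \<Rightarrow> 'v \<Rightarrow> 'v"
  assumes "w3_irreducible_quotient scale 1 0 0 L W one"
    and "omega = L (-2) one"
    and "w = W (-3) one"
    and "vertex_operator_algebra scale Y one omega 1"
    and "\<And>n. Y omega n = L (n - 1)"
    and "\<And>n. Y w n = W (n - 2)"
  shows "\<not> vertex_algebra.completely_reducible scale Y
            (vertex_algebra.generated_subalgebra scale Y one {omega})"
proof -
  interpret w3_irreducible_quotient scale 1 0 0 L W one
    by fact
  interpret vertex_operator_algebra scale Y one omega 1
    by fact
  interpret w3_c1_voa scale L W one Y omega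
    using assms by unfold_locales simp_all
  show ?thesis
    by (rule not_completely_reducible)
qed

end
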